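(* Let $g_+,g_-$ be two real-analytic exact symplectic twist maps which depend analytically also on a parameter $\varepsilon>0$. Assume that there exists $\rho>0$ such that for all sufficiently small $\varepsilon$ the maps $g_\pm$ are defined in a $\rho$-neighborhood, in $(\mathbb C/2\pi\mathbb Z)\times\mathbb C$, of the annulus $A=\mathbb T\times[a,b]$ and are of the form \[ g_\pm:(\alpha,G)\mapsto\big(\alpha+\varepsilon\,\omega(G;\varepsilon),\ G+\delta(\varepsilon)\,r(\alpha,G)\big)+o_\rho(\delta(\varepsilon)), \] with the same $\omega,r$ for both maps, where \[ \inf_{G\in[a,b]}|\omega(G;0)|\neq0,\qquad r=\mathcal O_\rho(1), \] and $\delta(\varepsilon)>0$ satisfies $\lim_{\varepsilon\to0}\delta(\varepsilon)/\varepsilon=0$. Let \[ f(\alpha,G)=\big(-\delta(\varepsilon)r(\alpha,G),\ \varepsilon\,\omega(G;\varepsilon)\big) \] and assume that there exist $\eta(\varepsilon)>0$ and a vertical strip $\mathbb I=(\alpha_1,\alpha_2)\times[a,b]$ on which \[ \inf_{(\alpha,G)\in\mathbb I}\big|\langle f,\ g_+-g_-\rangle(\alpha,G)\big|\ge\eta(\varepsilon)>0 \] and, for all $(\alpha,G)\in\mathbb I$, \[ \lim_{\varepsilon\to0}\frac{\delta(\varepsilon)\,|(g_+-g_-)(\alpha,G)|}{\eta(\varepsilon)}=0. \] Then, if there exists $c>0$ independent of $\varepsilon$ such that \[ \lim_{\varepsilon\to0}\ \frac{\sqrt{\delta(\varepsilon)\exp(-c/\varepsilon)}}{\varepsilon\,\inf_{G\in[a,b]}|\omega'(G;\varepsilon)|\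 \eta(\varepsilon)}=0, \] the maps $g_+$ and $g_-$ share, for all sufficiently small $\varepsilon$, no common essential invariant curve on $A_\varepsilon=\mathbb T\times[a+\varepsilon^{1/4},\,b-\varepsilon^{1/4}]$.
   Context: $\mathbb T=\mathbb R/2\pi\mathbb Z$; the symplectic form on $A$ is $dG\wedge d\alpha$; $\langle\cdot,\cdot\rangle$ is the standard scalar product on $\mathbb R^2$; $\omega'=\partial_G\omega$. An essential invariant curve of a map of the annulus is an invariant homotopically non-trivial simple closed curve. Let $A_\rho$ denote the complex $\rho$-neighborhood of $A$. For a function $h$ on $A_\rho$ (depending on $\varepsilon$), $h=\mathcal O_\rho(\epsilon_1(\varepsilon))$ means that there is $C>0$ independent of $\varepsilon$ with $|h|\le C\epsilon_1(\varepsilon)$ uniformly on $A_\rho$ as $\varepsilon\to0$, and $h=o_\rho(\epsilon_1(\varepsilon))$ means $\lim_{\varepsilon\to0}|h|/\epsilon_1(\varepsilon)=0$ uniformly on $A_\rho$. The difference $g_+-g_-$ is the ($o_\rho(\delta(\varepsilon))$-small) difference of the remainders of the two maps, viewed as an $\mathbb R^2$-valued function.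
   Formalization: The limit of δ(ε)|g_+ − g_-|/η(ε) is assumed uniform on the strip I (with a merely pointwise limit the claim is false); ω is assumed continuous up to ε = 0 and inf|ω'(G;ε)| > 0 for small ε, so that ω(G;0) and the last fraction are meaningful. *)

theory Defs
  imports "HOL-Analysis.Analysis"
begin

subsection \<open>Annuli, their universal covers and complex neighborhoods\<close>

text \<open>
  The circle \<open>\<real> / 2\<pi>\<int>\<close> is modelled by the unit circle in the complex plane, with covering map
  \<open>\<alpha> \<mapsto> cis \<alpha>\<close>.  Maps of the annulus, and of its complex neighborhoods in
  \<open>(\<complex> / 2\<pi>\<int>) \<times> \<complex>\<close>, are given by lifts to the universal cover which commute with
  \<open>(\<alpha>, G) \<mapsto> (\<alpha> + 2\<pi>, G)\<close>.
\<close>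

definition annulus :: "real \<Rightarrow> real \<Rightarrow> (complex \<times> real) set" where
  "annulus a b = sphere 0 1 \<times> {a..b}"

definition cover :: "real \<times> real \<Rightarrow> complex \<times> real" where
  "cover x = (cis (fst x), snd x)"

definition cembed :: "real \<times> real \<Rightarrow> complex \<times> complex" where
  "cembed x = (complex_of_real (fst x), complex_of_real (snd x))"

definition cnbhd :: "real \<Rightarrow> real \<Rightarrow> real \<Rightarrow> (complex \<times> complex) set" where
  "cnbhd \<rho> a b = (\<Union>x\<in>UNIV \<times> {a..b}. ball (cembed x) \<rho>)"

definition real_map :: "(complex \<times> complex \<Rightarrow> complex \<times> complex) \<Rightarrow> real \<times> real \<Rightarrow> real \<times> real" where
  "real_map g x = (Re (fst (g (cembed x))), Re (snd (g (cembed x))))"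


subsection \<open>Analyticity in several variables\<close>

definition holomorphic2_on :: "(complex \<times> complex \<Rightarrow> complex) \<Rightarrow> (complex \<times> complex) set \<Rightarrow> bool" where
  "holomorphic2_on h U \<longleftrightarrow>
     (\<forall>x\<in>U. \<exists>A B. (h has_derivative (\<lambda>(u, v). A * u + B * v)) (at x))"

definition holomorphic3_on ::
  "(complex \<times> complex \<times> complex \<Rightarrow> complex) \<Rightarrow> (complex \<times> complex \<times> complex) set \<Rightarrow> bool" where
  "holomorphic3_on h U \<longleftrightarrow>
     (\<forall>x\<in>U. \<exists>A B C. (h has_derivative (\<lambda>(u, v, w). A * u + B * v + C * w)) (at x))"

text \<open>
  Joint analyticity in \<open>(\<alpha>, G)\<close> and the real parameter \<open>\<epsilon>\<close>: the family extends holomorphically to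
  some open set of complex \<open>(\<alpha>, G, \<epsilon>)\<close>.  No uniform width in the \<open>\<epsilon>\<close>-direction is required.
\<close>

definition analytic_family ::
  "(real \<Rightarrow> complex \<times> complex \<Rightarrow> complex \<times> complex) \<Rightarrow> (complex \<times> complex) set \<Rightarrow> real set \<Rightarrow> bool" where
  "analytic_family g S E \<longleftrightarrow>
     (\<exists>U \<Gamma>. open U \<and> holomorphic3_on (fst \<circ> \<Gamma>) U \<and> holomorphic3_on (snd \<circ> \<Gamma>) U \<and>
        (\<forall>p\<in>S. \<forall>\<epsilon>\<in>E. (fst p, snd p, complex_of_real \<epsilon>) \<in> U \<and>
                     \<Gamma> (fst p, snd p, complex_of_real \<epsilon>) = g \<epsilon> p))"


subsection \<open>Exact symplectic twist maps\<close>

text \<open>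
  \<open>F\<close> is a lift, \<open>F\<^sup>*(G d\<alpha>) - G d\<alpha> = dS\<close> with a generating function \<open>S\<close> which is well defined
  on the annulus, i.e. periodic.  Taking the exterior derivative, \<open>F\<close> preserves \<open>dG \<and> d\<alpha>\<close>.
\<close>

definition exact_symplectic_on :: "(real \<times> real) set \<Rightarrow> (real \<times> real \<Rightarrow> real \<times> real) \<Rightarrow> bool" where
  "exact_symplectic_on X F \<longleftrightarrow>
     F differentiable_on X \<and>
     (\<exists>S :: real \<times> real \<Rightarrow> real.
        (\<forall>x\<in>X. S (fst x + 2 * pi, snd x) = S x) \<and>
        (\<forall>x\<in>X. (S has_derivative
            (\<lambda>v. snd (F x) * fst (frechet_derivative F (at x) v) - snd x * fst v)) (at x within X)))"

definition twist_on :: "(real \<times> real) set \<Rightarrow> (real \<times> real \<Rightarrow> real \<times> real) \<Rightarrow> bool" where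
  "twist_on X F \<longleftrightarrow> (\<forall>x\<in>X. fst (frechet_derivative F (at x) (0, 1)) \<noteq> 0)"

definition exact_symplectic_twist_family ::
  "real \<Rightarrow> real \<Rightarrow> real \<Rightarrow> real \<Rightarrow> (real \<Rightarrow> complex \<times> complex \<Rightarrow> complex \<times> complex) \<Rightarrow> bool" where
  "exact_symplectic_twist_family \<rho> a b \<epsilon>0 g \<longleftrightarrow>
     analytic_family g (cnbhd \<rho> a b) {0<..<\<epsilon>0} \<and>
     (\<forall>\<epsilon>\<in>{0<..<\<epsilon>0}.
        (\<forall>p\<in>cnbhd \<rho> a b. g \<epsilon> (fst p + complex_of_real (2 * pi), snd p) = g \<epsilon> p + (complex_of_real (2 * pi), 0)) \<and>
        (\<forall>x. cembed x \<in> cnbhd \<rho> a b \<longrightarrow> g \<epsilon> (cembed x) \<in> range cembed) \<and>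
        exact_symplectic_on (UNIV \<times> {a..b}) (real_map (g \<epsilon>)) \<and>
        twist_on (UNIV \<times> {a..b}) (real_map (g \<epsilon>)))"


subsection \<open>Uniform Landau symbols as \<open>\<epsilon> \<rightarrow> 0\<^sup>+\<close>\<close>

definition unif_bigo ::
  "'p set \<Rightarrow> (real \<Rightarrow> 'p \<Rightarrow> 'v::real_normed_vector) \<Rightarrow> (real \<Rightarrow> real) \<Rightarrow> bool" where
  "unif_bigo S h e \<longleftrightarrow> (\<exists>C>0. \<forall>\<^sub>F \<epsilon> in at_right 0. \<forall>p\<in>S. norm (h \<epsilon> p) \<le> C * e \<epsilon>)"

definition unif_smallo ::
  "'p set \<Rightarrow> (real \<Rightarrow> 'p \<Rightarrow> 'v::real_normed_vector) \<Rightarrow> (real \<Rightarrow> real) \<Rightarrow> bool" where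
  "unif_smallo S h e \<longleftrightarrow> uniform_limit S (\<lambda>\<epsilon> p. norm (h \<epsilon> p) / e \<epsilon>) (\<lambda>_. 0) (at_right 0)"


subsection \<open>Essential invariant curves\<close>

definition essential_curve :: "(complex \<times> real) set \<Rightarrow> (complex \<times> real) set \<Rightarrow> bool" where
  "essential_curve X C \<longleftrightarrow>
     (\<exists>\<gamma>. simple_path \<gamma> \<and> pathfinish \<gamma> = pathstart \<gamma> \<and> path_image \<gamma> = C \<and> C \<subseteq> X \<and>
          \<not> (\<exists>p. homotopic_loops X \<gamma> (linepath p p)))"

text \<open>
  For a lift \<open>F\<close> of a map \<open>f\<close> of the annulus one has \<open>f \<circ> cover = cover \<circ> F\<close>, so the left-hand side
  is the image \<open>f(C)\<close>.
\<close>

definition invariant_under :: "(real \<times> real \<Rightarrow> real \<times> real) \<Rightarrow> (complex \<times> real) set \<Rightarrow> bool" where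
  "invariant_under F C \<longleftrightarrow> cover ` (F ` (cover -` C)) = C"

definition essential_invariant_curve ::
  "(complex \<times> real) set \<Rightarrow> (real \<times> real \<Rightarrow> real \<times> real) \<Rightarrow> (complex \<times> real) set \<Rightarrow> bool" where
  "essential_invariant_curve X F C \<longleftrightarrow> essential_curve X C \<and> invariant_under F C"

end

theory Submission
  imports Defs
begin

text \<open>
  The proof exhibits a drift that no nonempty compact subset of the annulus can sustain.  Let \<open>S\<close> be the lift
  to the universal cover of a common invariant curve; write \<open>F\<close>, \<open>H\<close> for the real lifts of the two
  maps.  Then \<open>S\<close> is closed, its actions \<open>G\<close> are bounded, and \<open>F(S) = S = H(S)\<close>.  Two kinds of moves
  stay inside \<open>S\<close>:
  \<^item> \<open>F\<close> and its inverse branches move \<open>\<alpha>\<close> by at least a constant times \<open>\<epsilon>\<close>, in opposite directions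
    (\<open>\<omega>\<close> has no zero), while \<open>G\<close> changes by \<open>O(\<delta>)\<close>: slope at most of order \<open>\<delta>/\<epsilon>\<close>;
  \<^item> over the vertical strip, one goes from \<open>H(q)\<close> to \<open>F(q)\<close> or back.  Since \<open>\<delta>\<bar>F - H\<bar>\<close> is small
    compared with \<open>\<eta>\<close>, the transversality bound must come from the action component, so
    \<open>\<epsilon>\<bar>\<omega>\<bar> \<bar>G(F q) - G(H q)\<bar> \<ge> \<eta>/2\<close>, and this displacement is far steeper than \<open>\<delta>/\<epsilon>\<close>.  The sign of
    its action component is constant on the connected strip, so one of the two directions always
    raises \<open>G\<close>.

  Choose a slope \<open>\<mu>\<close> between the two, let \<open>m\<close> be the middle of the strip, and maximize
  \<open>G - \<mu>\<bar>\<alpha> - m\<bar>\<close> over \<open>S\<close>.  Far from \<open>m\<close>, a step of \<open>F\<close> or of its inverse towards \<open>m\<close> increases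
  this function; near \<open>m\<close>, the steep displacement does.  So there is no maximum, although \<open>S\<close> is
  closed and the function tends to \<open>-\<infinity>\<close> as \<open>\<bar>\<alpha>\<bar> \<rightarrow> \<infinity>\<close>: a contradiction
  (\<open>no_closed_set_with_drift\<close>, applied in \<open>no_common_invariant_lift\<close>).  The lemma
  \<open>splitting_estimate\<close> is the steepness of \<open>F - H\<close>, and \<open>lift_image_eq\<close> transfers invariance to
  the cover.

  The argument needs neither that the curve is a graph over the angle, nor that it is close to a
  level set of an averaged Hamiltonian.
\<close>

section \<open>Drift in a closed set\<close>

text \<open>
  The assumptions \<open>right\<close> and \<open>left\<close> provide flat moves everywhere on \<open>S\<close>, and \<open>up\<close> provides steep
  moves near the vertical line \<open>fst y = m\<close>; \<open>\<mu>\<close> separates the two slopes.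
\<close>

lemma no_closed_set_with_drift:
  fixes S :: "(real \<times> real) set"
  assumes "closed S" and "S \<noteq> {}" and S_sub: "S \<subseteq> UNIV \<times> {a..b}"
    and right: "\<And>y. y \<in> S \<Longrightarrow> \<exists>z\<in>S. c \<le> fst z - fst y \<and> fst z - fst y \<le> l \<and> \<bar>snd z - snd y\<bar> \<le> \<kappa>"
    and left: "\<And>y. y \<in> S \<Longrightarrow> \<exists>z\<in>S. c \<le> fst y - fst z \<and> fst y - fst z \<le> l \<and> \<bar>snd z - snd y\<bar> \<le> \<kappa>"
    and up: "\<And>y. y \<in> S \<Longrightarrow> \<bar>fst y - m\<bar> \<le> l \<Longrightarrow> \<exists>z\<in>S. \<mu> * \<bar>fst z - fst y\<bar> < snd z - snd y"
    and "\<kappa> < \<mu> * c" and "\<mu> > 0"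
  shows False
proof -
  define \<Phi> where "\<Phi> y = snd y - \<mu> * \<bar>fst y - m\<bar>" for y :: "real \<times> real"
  obtain s where s: "s \<in> S" using \<open>S \<noteq> {}\<close> by blast
  \<comment> \<open>At points of \<open>S\<close> outside the slab \<open>\<bar>fst z - m\<bar> \<le> R\<close>, the function \<open>\<Phi>\<close> is at most \<open>\<Phi> s\<close>.\<close>
  define R where "R = \<bar>fst s - m\<bar> + (b - a) / \<mu>"
  let ?K = "S \<inter> ({m - R..m + R} \<times> {a..b})"
  have ab: "a \<le> b" using s S_sub by force
  have "compact ?K"
    by (intro closed_Int_compact \<open>closed S\<close> compact_Times compact_Icc)
  moreover have "s \<in> ?K"
  proof -
    have "(b - a) / \<mu> \<ge> 0" using ab \<open>\<mu> > 0\<close> by simp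
    then have "fst s \<in> {m - R..m + R}" unfolding R_def by auto
    then show ?thesis using s S_sub by (auto simp: mem_Times_iff)
  qed
  moreover have "continuous_on ?K \<Phi>"
    unfolding \<Phi>_def by (intro continuous_intros)
  ultimately obtain y where y: "y \<in> ?K" and y_max: "\<And>z. z \<in> ?K \<Longrightarrow> \<Phi> z \<le> \<Phi> y"
    using continuous_attains_sup[of ?K \<Phi>] by blast
  have max: "\<Phi> z \<le> \<Phi> y" if z: "z \<in> S" for z
  proof (cases "\<bar>fst z - m\<bar> \<le> R")
    case True
    then have "z \<in> ?K" using z S_sub by (auto simp: mem_Times_iff)
    then show ?thesis by (rule y_max)
  next
    case False
    then have "\<mu> * R \<le> \<mu> * \<bar>fst z - m\<bar>" using \<open>\<mu> > 0\<close> by simp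
    moreover have "\<mu> * R = \<mu> * \<bar>fst s - m\<bar> + (b - a)"
      using \<open>\<mu> > 0\<close> by (simp add: R_def field_simps)
    moreover have "snd z \<le> b" "a \<le> snd s" using z s S_sub by auto
    ultimately have "\<Phi> z \<le> \<Phi> s" unfolding \<Phi>_def by linarith
    then show ?thesis using y_max[OF \<open>s \<in> ?K\<close>] by linarith
  qed
  have no_raise: "snd z - snd y \<le> \<mu> * (\<bar>fst z - m\<bar> - \<bar>fst y - m\<bar>)" if "z \<in> S" for z
    using max[OF that] by (simp add: \<Phi>_def algebra_simps)
  \<comment> \<open>A flat move that brings the angle closer to \<open>m\<close> by \<open>c\<close> gains \<open>\<mu> * c\<close> and loses at most \<open>\<kappa>\<close>.\<close>
  have no_approach: False
    if "z \<in> S" "\<bar>fst z - m\<bar> + c \<le> \<bar>fst y - m\<bar>" "\<bar>snd z - snd y\<bar> \<le> \<kappa>" for z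
  proof -
    have "\<mu> * (\<bar>fst z - m\<bar> - \<bar>fst y - m\<bar>) \<le> \<mu> * (- c)"
      using that \<open>\<mu> > 0\<close> by (intro mult_left_mono) auto
    then show False using no_raise[of z] that \<open>\<kappa> < \<mu> * c\<close> by simp
  qed
  consider "\<bar>fst y - m\<bar> \<le> l" | "fst y \<ge> m + l" | "fst y \<le> m - l" by linarith
  then show False
  proof cases
    case 1
    then obtain z where z: "z \<in> S" "\<mu> * \<bar>fst z - fst y\<bar> < snd z - snd y"
      using up y by blast
    have "\<mu> * (\<bar>fst z - m\<bar> - \<bar>fst y - m\<bar>) \<le> \<mu> * \<bar>fst z - fst y\<bar>"
      using \<open>\<mu> > 0\<close> by (intro mult_left_mono) auto
    then show False using no_raise[of z] z by linarith
  next
    case 2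
    then obtain z where "z \<in> S" "c \<le> fst y - fst z" "fst y - fst z \<le> l" "\<bar>snd z - snd y\<bar> \<le> \<kappa>"
      using left y by blast
    with 2 show False by (intro no_approach[of z]) auto
  next
    case 3
    then obtain z where "z \<in> S" "c \<le> fst z - fst y" "fst z - fst y \<le> l" "\<bar>snd z - snd y\<bar> \<le> \<kappa>"
      using right y by blast
    with 3 show False by (intro no_approach[of z]) auto
  qed
qed

section \<open>Two maps sharing an invariant set\<close>

lemma constant_sign:
  fixes u :: "'a::real_normed_vector \<Rightarrow> real"
  assumes "connected X" and "continuous_on X u" and "\<And>x. x \<in> X \<Longrightarrow> u x \<noteq> 0"
  shows "(\<forall>x\<in>X. u x > 0) \<or> (\<forall>x\<in>X. u x < 0)"
proof (rule ccontr)
  assume "\<not> ?thesis"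
  then obtain x y where "x \<in> X" "y \<in> X" "u x \<le> 0" "u y \<ge> 0"
    by (meson not_less)
  moreover have "connected (u ` X)"
    using assms by (intro connected_continuous_image)
  ultimately have "0 \<in> u ` X"
    by (meson connectedD_interval imageI)
  then show False using assms by auto
qed

text \<open>
  Here \<open>u\<close> is the unperturbed angular displacement.  The strip must be wide enough to contain the
  preimage under either map of a point at angular distance at most \<open>l\<close> from its middle.
\<close>

lemma no_common_invariant_lift:
  fixes F H :: "real \<times> real \<Rightarrow> real \<times> real" and u :: "real \<Rightarrow> real"
  assumes S: "closed S" "S \<noteq> {}" "S \<subseteq> UNIV \<times> {a..b}" and "F ` S = S" and "H ` S = S"
    and cont: "continuous_on (UNIV \<times> {a..b}) F" "continuous_on (UNIV \<times> {a..b}) H"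
              "continuous_on {a..b} u"
    and u: "\<And>G. G \<in> {a..b} \<Longrightarrow> c \<le> \<bar>u G\<bar> - \<delta> \<and> \<bar>u G\<bar> + \<delta> \<le> l"
    and F: "\<And>x. x \<in> UNIV \<times> {a..b} \<Longrightarrow> \<bar>fst (F x) - fst x - u (snd x)\<bar> \<le> \<delta> \<and> \<bar>snd (F x) - snd x\<bar> \<le> \<kappa>"
    and H: "\<And>x. x \<in> UNIV \<times> {a..b} \<Longrightarrow> \<bar>fst (H x) - fst x - u (snd x)\<bar> \<le> \<delta>"
    and split: "\<And>x. x \<in> {\<alpha><..<\<beta>} \<times> {a..b} \<Longrightarrow>
                  \<mu> * \<bar>fst (F x) - fst (H x)\<bar> < \<bar>snd (F x) - snd (H x)\<bar>"
    and "c > 0" "\<delta> > 0" "\<mu> > 0" "\<kappa> < \<mu> * c" and width: "4 * l < \<beta> - \<alpha>"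
  shows False
proof -
  define m where "m = (\<alpha> + \<beta>) / 2"
  have S': "snd x \<in> {a..b}" "x \<in> UNIV \<times> {a..b}" if "x \<in> S" for x
    using S that by auto
  have pre_F: "\<exists>q\<in>S. F q = y" and pre_H: "\<exists>q\<in>S. H q = y" if "y \<in> S" for y
    using \<open>F ` S = S\<close> \<open>H ` S = S\<close> that by (metis imageE)+
  have im: "F x \<in> S" "H x \<in> S" if "x \<in> S" for x
    using \<open>F ` S = S\<close> \<open>H ` S = S\<close> that by blast+
  have u_sign: "(\<forall>G\<in>{a..b}. u G > 0) \<or> (\<forall>G\<in>{a..b}. u G < 0)"
    using cont(3) u \<open>c > 0\<close> \<open>\<delta> > 0\<close> by (intro constant_sign) force+
  \<comment> \<open>The two directions are realized by \<open>F y\<close> and by a preimage of \<open>y\<close>, in the order given by the sign of \<open>u\<close>.\<close>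
  have move: "\<exists>z\<in>S. \<exists>z'\<in>S. c \<le> fst z - fst y \<and> fst z - fst y \<le> l \<and> \<bar>snd z - snd y\<bar> \<le> \<kappa> \<and>
                c \<le> fst y - fst z' \<and> fst y - fst z' \<le> l \<and> \<bar>snd z' - snd y\<bar> \<le> \<kappa>"
    if y: "y \<in> S" for y
  proof -
    obtain q where q: "q \<in> S" "F q = y" using pre_F y by blast
    note est = F[OF S'(2)[OF y]] F[OF S'(2)[OF q(1)]] u[OF S'(1)[OF y]] u[OF S'(1)[OF q(1)]]
    from u_sign show ?thesis
    proof
      assume "\<forall>G\<in>{a..b}. u G > 0"
      then have "u (snd y) > 0" "u (snd q) > 0" using S' y q by auto
      then show ?thesis using est q im[OF y]
        by (intro bexI[of _ "F y"] bexI[of _ q]) auto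
    next
      assume "\<forall>G\<in>{a..b}. u G < 0"
      then have "u (snd y) < 0" "u (snd q) < 0" using S' y q by auto
      then show ?thesis using est q im[OF y]
        by (intro bexI[of _ q] bexI[of _ "F y"]) auto
    qed
  qed
  have near: "q \<in> {\<alpha><..<\<beta>} \<times> {a..b}"
    if "q \<in> S" "\<bar>fst y - m\<bar> \<le> l" "\<bar>fst y - fst q - u (snd q)\<bar> \<le> \<delta>" for q y :: "real \<times> real"
  proof -
    have "\<bar>fst q - m\<bar> \<le> 2 * l" using that u[OF S'(1)[OF that(1)]] by linarith
    then have "fst q \<in> {\<alpha><..<\<beta>}" using width unfolding m_def by (auto simp: abs_le_iff field_simps)
    then show ?thesis using S'[OF that(1)] by (simp add: mem_Times_iff)
  qed
  have split_sign: "(\<forall>x\<in>{\<alpha><..<\<beta>} \<times> {a..b}. snd (F x) - snd (H x) > 0) \<or>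
                    (\<forall>x\<in>{\<alpha><..<\<beta>} \<times> {a..b}. snd (F x) - snd (H x) < 0)"
  proof (rule constant_sign)
    show "connected ({\<alpha><..<\<beta>} \<times> {a..b})"
      by (intro connected_Times connected_Ioo connected_Icc)
    show "continuous_on ({\<alpha><..<\<beta>} \<times> {a..b}) (\<lambda>x. snd (F x) - snd (H x))"
      by (intro continuous_intros continuous_on_subset[OF cont(1)] continuous_on_subset[OF cont(2)]) auto
    show "snd (F x) - snd (H x) \<noteq> 0" if "x \<in> {\<alpha><..<\<beta>} \<times> {a..b}" for x
    proof -
      have "0 \<le> \<mu> * \<bar>fst (F x) - fst (H x)\<bar>" using \<open>\<mu> > 0\<close> by simp
      then show ?thesis using split[OF that] by linarith
    qed
  qed
  \<comment> \<open>Passing from \<open>H q\<close> to \<open>F q\<close>, or from \<open>F q\<close> to \<open>H q\<close>, raises the action, depending on the sign of the splitting.\<close>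
  have up: "\<exists>z\<in>S. \<mu> * \<bar>fst z - fst y\<bar> < snd z - snd y" if y: "y \<in> S" "\<bar>fst y - m\<bar> \<le> l" for y
    using split_sign
  proof
    assume pos: "\<forall>x\<in>{\<alpha><..<\<beta>} \<times> {a..b}. snd (F x) - snd (H x) > 0"
    obtain q where q: "q \<in> S" "H q = y" using pre_H y by blast
    then have "q \<in> {\<alpha><..<\<beta>} \<times> {a..b}" using near H[OF S'(2)] y by blast
    then have "\<mu> * \<bar>fst (F q) - fst y\<bar> < snd (F q) - snd y"
      using split[of q] pos[rule_format, of q] q(2) by simp
    then show ?thesis using im q(1) by blast
  next
    assume neg: "\<forall>x\<in>{\<alpha><..<\<beta>} \<times> {a..b}. snd (F x) - snd (H x) < 0"
    obtain q where q: "q \<in> S" "F q = y" using pre_F y by blast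
    then have "q \<in> {\<alpha><..<\<beta>} \<times> {a..b}" using near F[OF S'(2)] y by blast
    then have "\<mu> * \<bar>fst (H q) - fst y\<bar> < snd (H q) - snd y"
      using split[of q] neg[rule_format, of q] q(2) abs_minus_commute[of "fst y" "fst (H q)"] by simp
    then show ?thesis using im q(1) by blast
  qed
  show False
    using no_closed_set_with_drift[OF S _ _ up \<open>\<kappa> < \<mu> * c\<close> \<open>\<mu> > 0\<close>] move by blast
qed

section \<open>Invariant curves in the universal cover\<close>

text \<open>
  Invariance of \<open>C\<close> under the induced map of the annulus determines preimages in the cover only up to
  a translation by a multiple of \<open>2\<pi>\<close>; the periodicity of \<open>F\<close> removes this ambiguity.
\<close>

lemma lift_image_eq:
  fixes F :: "real \<times> real \<Rightarrow> real \<times> real"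
  assumes inv: "invariant_under F C" and sub: "cover -` C \<subseteq> UNIV \<times> {a..b}"
    and per: "\<And>x. x \<in> UNIV \<times> {a..b} \<Longrightarrow> F (fst x + 2 * pi, snd x) = F x + (2 * pi, 0)"
  shows "F ` (cover -` C) = cover -` C"
proof
  show "F ` (cover -` C) \<subseteq> cover -` C"
    using inv by (auto simp: invariant_under_def)
next
  have nat_shift: "F (fst x + 2 * pi * real n, snd x) = F x + (2 * pi * real n, 0)"
    if "x \<in> UNIV \<times> {a..b}" for n x
  proof (induction n)
    case 0
    then show ?case by (simp add: prod_eq_iff)
  next
    case (Suc n)
    show ?case
      using per[of "(fst x + 2 * pi * real n, snd x)"] that Suc
      by (simp add: algebra_simps mem_Times_iff)
  qed
  have int_shift: "F (fst x + 2 * pi * of_int k, snd x) = F x + (2 * pi * of_int k, 0)"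
    if "x \<in> UNIV \<times> {a..b}" for k x
  proof (cases "k \<ge> 0")
    case True
    then show ?thesis using nat_shift[OF that, of "nat k"] by simp
  next
    case False
    then show ?thesis
      using nat_shift[of "(fst x + 2 * pi * of_int k, snd x)" "nat (- k)"] that
      by (simp add: mem_Times_iff prod_eq_iff)
  qed
  show "cover -` C \<subseteq> F ` (cover -` C)"
  proof
    fix y assume "y \<in> cover -` C"
    then have "cover y \<in> cover ` F ` (cover -` C)"
      using inv by (simp add: invariant_under_def)
    then obtain x where x: "x \<in> cover -` C" "cover y = cover (F x)" by blast
    then have "cis (fst y) = cis (fst (F x))" and snd_eq: "snd y = snd (F x)"
      by (auto simp: cover_def)
    then have "sin (fst y) = sin (fst (F x)) \<and> cos (fst y) = cos (fst (F x))"
      by (simp add: complex_eq_iff)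
    then obtain k :: int where k: "fst y = fst (F x) + 2 * pi * of_int k"
      by (auto simp: sin_cos_eq_iff)
    let ?x = "(fst x + 2 * pi * of_int k, snd x)"
    have "cis (2 * pi * of_int k) = 1"
      by (simp add: complex_eq_iff cos_int_2pin sin_int_2pin)
    then have "cover ?x = cover x"
      by (simp add: cover_def flip: cis_mult)
    moreover have "F ?x = y"
      using int_shift[of x k] subsetD[OF sub x(1)] k snd_eq by (simp add: prod_eq_iff)
    ultimately show "y \<in> F ` (cover -` C)"
      using x by (intro image_eqI[of _ _ ?x]) auto
  qed
qed

lemma lifted_curve:
  assumes "essential_curve (annulus a' b') C" and "a \<le> a'" and "b' \<le> b"
  shows "closed (cover -` C)" and "cover -` C \<noteq> {}" and "cover -` C \<subseteq> UNIV \<times> {a..b}"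
proof -
  obtain \<gamma> where \<gamma>: "simple_path \<gamma>" "path_image \<gamma> = C" "C \<subseteq> annulus a' b'"
    using assms(1) unfolding essential_curve_def by blast
  then have "closed C"
    using simple_path_imp_path closed_path_image by blast
  moreover have "continuous_on UNIV cover"
    unfolding cover_def[abs_def] by (intro continuous_intros)
  ultimately show "closed (cover -` C)"
    by (rule closed_vimage)
  obtain z G where zG: "(z, G) \<in> C" using path_image_nonempty[of \<gamma>] \<gamma> by auto
  then have "norm z = 1" using \<gamma>(3) by (auto simp: annulus_def)
  then have "cover (Arg z, G) = (z, G)"
    using rcis_cmod_Arg[of z] by (simp add: cover_def rcis_def)
  with zG show "cover -` C \<noteq> {}" by (metis empty_iff vimage_eq)
  show "cover -` C \<subseteq> UNIV \<times> {a..b}"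
    using \<gamma>(3) assms(2,3) by (fastforce simp: annulus_def cover_def)
qed

section \<open>Estimates for small parameters\<close>

lemma cembed_in_cnbhd: "x \<in> UNIV \<times> {a..b} \<Longrightarrow> \<rho> > 0 \<Longrightarrow> cembed x \<in> cnbhd \<rho> a b"
  unfolding cnbhd_def by (intro UN_I[of x]) auto

lemma real_map_estimate:
  assumes "\<rho> > 0"
    and form: "unif_smallo (cnbhd \<rho> a b)
          (\<lambda>\<epsilon> (\<alpha>, G). g \<epsilon> (\<alpha>, G) -
             (\<alpha> + of_real \<epsilon> * \<omega> G \<epsilon>, G + of_real (\<delta> \<epsilon>) * r \<epsilon> (\<alpha>, G))) \<delta>"
    and \<delta>_pos: "\<forall>\<^sub>F \<epsilon> in at_right 0. \<delta> \<epsilon> > 0"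
    and r_bound: "\<forall>\<^sub>F \<epsilon> in at_right 0. \<forall>p\<in>cnbhd \<rho> a b. norm (r \<epsilon> p) \<le> B"
  shows "\<forall>\<^sub>F \<epsilon> in at_right 0. \<forall>x\<in>UNIV \<times> {a..b}.
           \<bar>fst (real_map (g \<epsilon>) x) - fst x - \<epsilon> * Re (\<omega> (of_real (snd x)) \<epsilon>)\<bar> \<le> \<delta> \<epsilon> \<and>
           \<bar>snd (real_map (g \<epsilon>) x) - snd x\<bar> \<le> (B + 1) * \<delta> \<epsilon>"
proof -
  let ?h = "\<lambda>\<epsilon> (\<alpha>, G). g \<epsilon> (\<alpha>, G) -
             (\<alpha> + of_real \<epsilon> * \<omega> G \<epsilon>, G + of_real (\<delta> \<epsilon>) * r \<epsilon> (\<alpha>, G))"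
  have norm_fst: "norm (fst z) \<le> norm z" and norm_snd: "norm (snd z) \<le> norm z"
    for z :: "complex \<times> complex"
    by (metis norm_fst_le norm_snd_le prod.collapse)+
  have "\<forall>\<^sub>F \<epsilon> in at_right 0. \<forall>p\<in>cnbhd \<rho> a b. dist (norm (?h \<epsilon> p) / \<delta> \<epsilon>) 0 < 1"
    using form unfolding unif_smallo_def uniform_limit_iff by (rule allE[of _ 1]) simp
  then show ?thesis
    using \<delta>_pos r_bound
  proof eventually_elim
    case (elim \<epsilon>)
    show ?case
    proof
      fix x :: "real \<times> real" assume x: "x \<in> UNIV \<times> {a..b}"
      note mem = cembed_in_cnbhd[OF x \<open>\<rho> > 0\<close>]
      let ?p = "cembed x"
      have "norm (?h \<epsilon> ?p) \<le> \<delta> \<epsilon>"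
        using elim(1)[rule_format, OF mem] elim(2) by (simp add: field_simps)
      then have h: "norm (fst (?h \<epsilon> ?p)) \<le> \<delta> \<epsilon>" "norm (snd (?h \<epsilon> ?p)) \<le> \<delta> \<epsilon>"
        by (rule order_trans[OF norm_fst], rule order_trans[OF norm_snd])
      have "\<bar>Re (fst (?h \<epsilon> ?p))\<bar> \<le> \<delta> \<epsilon>" "\<bar>Re (snd (?h \<epsilon> ?p))\<bar> \<le> \<delta> \<epsilon>"
        using order_trans[OF abs_Re_le_cmod h(1)] order_trans[OF abs_Re_le_cmod h(2)] .
      then have 1: "\<bar>fst (real_map (g \<epsilon>) x) - fst x - \<epsilon> * Re (\<omega> (of_real (snd x)) \<epsilon>)\<bar> \<le> \<delta> \<epsilon>"
        and 2: "\<bar>snd (real_map (g \<epsilon>) x) - snd x - \<delta> \<epsilon> * Re (r \<epsilon> ?p)\<bar> \<le> \<delta> \<epsilon>"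
        by (simp_all add: real_map_def cembed_def algebra_simps)
      have "\<bar>Re (r \<epsilon> ?p)\<bar> \<le> B"
        using order_trans[OF abs_Re_le_cmod elim(3)[rule_format, OF mem]] .
      then have "\<bar>\<delta> \<epsilon> * Re (r \<epsilon> ?p)\<bar> \<le> B * \<delta> \<epsilon>"
        using elim(2) by (simp add: abs_mult mult.commute)
      with 1 2 show "\<bar>fst (real_map (g \<epsilon>) x) - fst x - \<epsilon> * Re (\<omega> (of_real (snd x)) \<epsilon>)\<bar> \<le> \<delta> \<epsilon> \<and>
           \<bar>snd (real_map (g \<epsilon>) x) - snd x\<bar> \<le> (B + 1) * \<delta> \<epsilon>"
        by (simp add: algebra_simps)
    qed
  qed
qed

text \<open>
  A frequency that is bounded away from zero at parameter \<open>0\<close> remains so for small positive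
  parameters, by uniform continuity on a compact set.
\<close>

lemma frequency_bounds:
  fixes u :: "real \<Rightarrow> real \<Rightarrow> real"
  assumes "a \<le> b" and "\<epsilon>0 > 0"
    and cont: "continuous_on ({a..b} \<times> {0..<\<epsilon>0}) (\<lambda>(G, \<epsilon>). u G \<epsilon>)"
    and nz: "(INF G\<in>{a..b}. \<bar>u G 0\<bar>) \<noteq> 0"
  obtains w W where "0 < w" "w \<le> W"
    "\<forall>\<^sub>F \<epsilon> in at_right 0. \<forall>G\<in>{a..b}. w \<le> \<bar>u G \<epsilon>\<bar> \<and> \<bar>u G \<epsilon>\<bar> \<le> W"
proof -
  define w0 where "w0 = (INF G\<in>{a..b}. \<bar>u G 0\<bar>)"
  have w0_le: "w0 \<le> \<bar>u G 0\<bar>" if "G \<in> {a..b}" for G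
    unfolding w0_def using that by (intro cINF_lower bdd_belowI2[of _ 0]) auto
  have "w0 \<ge> 0" unfolding w0_def using \<open>a \<le> b\<close> by (intro cINF_greatest) auto
  then have "w0 > 0" using nz by (simp add: w0_def)
  let ?K = "{a..b} \<times> {0..\<epsilon>0 / 2}"
  have K: "compact ?K" by (intro compact_Times compact_Icc)
  have cont_K: "continuous_on ?K (\<lambda>(G, \<epsilon>). u G \<epsilon>)"
    using cont by (rule continuous_on_subset) (use \<open>\<epsilon>0 > 0\<close> in auto)
  have "bounded ((\<lambda>(G, \<epsilon>). u G \<epsilon>) ` ?K)"
    by (intro compact_imp_bounded compact_continuous_image cont_K K)
  then obtain W where W: "\<And>G \<epsilon>. (G, \<epsilon>) \<in> ?K \<Longrightarrow> \<bar>u G \<epsilon>\<bar> \<le> W"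
    unfolding bounded_iff by fastforce
  have "uniformly_continuous_on ?K (\<lambda>(G, \<epsilon>). u G \<epsilon>)"
    by (rule compact_uniformly_continuous[OF cont_K K])
  then obtain d where "d > 0" and d: "\<And>x y. x \<in> ?K \<Longrightarrow> y \<in> ?K \<Longrightarrow> dist y x < d \<Longrightarrow>
      dist (case y of (G, \<epsilon>) \<Rightarrow> u G \<epsilon>) (case x of (G, \<epsilon>) \<Rightarrow> u G \<epsilon>) < w0 / 2"
    unfolding uniformly_continuous_on_def using \<open>w0 > 0\<close> by (metis half_gt_zero)
  have ev: "w0 / 2 \<le> \<bar>u G \<epsilon>\<bar>" "\<bar>u G \<epsilon>\<bar> \<le> W"
    if "\<epsilon> > 0" "\<epsilon> < min d (\<epsilon>0 / 2)" "G \<in> {a..b}" for \<epsilon> G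
  proof -
    have "dist (u G \<epsilon>) (u G 0) < w0 / 2"
      using d[of "(G, 0)" "(G, \<epsilon>)"] that \<open>\<epsilon>0 > 0\<close> by (auto simp: dist_Pair_Pair)
    then show "w0 / 2 \<le> \<bar>u G \<epsilon>\<bar>"
      using w0_le[OF that(3)] unfolding dist_real_def by linarith
    show "\<bar>u G \<epsilon>\<bar> \<le> W" using W that by auto
  qed
  have "w0 / 2 \<le> W" using w0_le[of a] W[of a 0] \<open>w0 > 0\<close> \<open>\<epsilon>0 > 0\<close> \<open>a \<le> b\<close> by auto
  moreover have "\<forall>\<^sub>F \<epsilon> in at_right 0. \<forall>G\<in>{a..b}. w0 / 2 \<le> \<bar>u G \<epsilon>\<bar> \<and> \<bar>u G \<epsilon>\<bar> \<le> W"
    unfolding eventually_at_right_field using ev \<open>d > 0\<close> \<open>\<epsilon>0 > 0\<close>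
    by (intro exI[of _ "min d (\<epsilon>0 / 2)"]) auto
  ultimately show thesis using \<open>w0 > 0\<close> that[of "w0 / 2" W] by auto
qed

lemma real_map_family:
  assumes "exact_symplectic_twist_family \<rho> a b \<epsilon>0 g" and "\<rho> > 0" and "\<epsilon> \<in> {0<..<\<epsilon>0}"
  shows "continuous_on (UNIV \<times> {a..b}) (real_map (g \<epsilon>))"
    and "\<And>x. x \<in> UNIV \<times> {a..b} \<Longrightarrow>
           real_map (g \<epsilon>) (fst x + 2 * pi, snd x) = real_map (g \<epsilon>) x + (2 * pi, 0)"
proof -
  show "continuous_on (UNIV \<times> {a..b}) (real_map (g \<epsilon>))"
    using assms unfolding exact_symplectic_twist_family_def exact_symplectic_on_def
    by (intro differentiable_imp_continuous_on) blast
  fix x :: "real \<times> real" assume "x \<in> UNIV \<times> {a..b}"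
  then have "g \<epsilon> (fst (cembed x) + of_real (2 * pi), snd (cembed x)) = g \<epsilon> (cembed x) + (of_real (2 * pi), 0)"
    using assms cembed_in_cnbhd unfolding exact_symplectic_twist_family_def by blast
  then show "real_map (g \<epsilon>) (fst x + 2 * pi, snd x) = real_map (g \<epsilon>) x + (2 * pi, 0)"
    by (simp add: real_map_def cembed_def)
qed

text \<open>
  \<open>D1\<close> and \<open>D2\<close> are the angle and action components of the difference of the two maps, \<open>v\<close> is the
  frequency and \<open>k\<close> the value of \<open>r\<close>.  The slope on the left of the conclusion is
  \<open>2 (B + 2) \<delta> / (\<epsilon> w)\<close>: it exceeds the slope \<open>(B + 1) \<delta> / (\<epsilon> w / 2)\<close> that a single map can have
  when it moves the action by at most \<open>(B + 1) \<delta>\<close> and the angle by at least \<open>\<epsilon> w / 2\<close>.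
\<close>

lemma splitting_estimate:
  fixes D1 D2 :: real
  assumes "0 < w" "w \<le> W" "0 \<le> B" "0 < \<epsilon>" "0 < \<delta>" "0 < \<eta>" and "\<bar>v\<bar> \<le> W" and "\<bar>k\<bar> \<le> B"
    and big: "\<eta> \<le> \<bar>- \<delta> * k * D1 + \<epsilon> * v * D2\<bar>"
    and small: "\<delta> * norm (D1, D2) \<le> w / (32 * W * (B + 2)) * \<eta>"
  shows "2 * (B + 2) * \<delta> / (\<epsilon> * w) * \<bar>D1\<bar> < \<bar>D2\<bar>"
proof -
  have W: "W > 0" using assms by linarith
  have "\<bar>D1\<bar> \<le> norm (D1, D2)" using norm_fst_le[of D1 D2] by simp
  then have "\<delta> * \<bar>D1\<bar> \<le> \<delta> * norm (D1, D2)" using \<open>0 < \<delta>\<close> by simp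
  then have D1: "\<delta> * \<bar>D1\<bar> \<le> w / (32 * W * (B + 2)) * \<eta>" using small by linarith
  have "32 * W * (B + 2) * (\<delta> * \<bar>D1\<bar>) \<le> w * \<eta>"
    using mult_left_mono[OF D1, of "32 * W * (B + 2)"] W \<open>0 \<le> B\<close> by simp
  then have key: "32 * W * ((B + 2) * \<delta> * \<bar>D1\<bar>) \<le> w * \<eta>" by (simp add: algebra_simps)
  also have "\<dots> \<le> W * \<eta>" using assms by simp
  \<comment> \<open>The term containing \<open>D1\<close> is thus at most \<open>\<eta> / 32\<close>, so \<open>D2\<close> carries most of \<open>\<eta>\<close>.\<close>
  finally have "32 * ((B + 2) * \<delta> * \<bar>D1\<bar>) \<le> \<eta>" using W by (simp add: mult.assoc)
  moreover have "\<bar>\<delta> * k * D1\<bar> \<le> (B + 2) * \<delta> * \<bar>D1\<bar>"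
  proof -
    have "\<bar>\<delta> * k * D1\<bar> = \<bar>k\<bar> * (\<delta> * \<bar>D1\<bar>)" using \<open>0 < \<delta>\<close> by (simp add: abs_mult)
    also have "\<dots> \<le> (B + 2) * (\<delta> * \<bar>D1\<bar>)" using assms by (intro mult_right_mono) auto
    finally show ?thesis by (simp add: mult.assoc)
  qed
  moreover have "0 \<le> (B + 2) * \<delta> * \<bar>D1\<bar>" using assms by simp
  moreover have "\<bar>\<epsilon> * v * D2\<bar> \<le> \<epsilon> * W * \<bar>D2\<bar>"
    using assms by (simp add: abs_mult mult_left_mono mult_right_mono)
  ultimately have "\<eta> / 2 < \<epsilon> * W * \<bar>D2\<bar>" using big \<open>0 < \<eta>\<close> by linarith
  then have "w * \<eta> / 2 < w * (\<epsilon> * W * \<bar>D2\<bar>)" using \<open>0 < w\<close> by simp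
  then have "W * (16 * ((B + 2) * \<delta> * \<bar>D1\<bar>)) < W * (\<epsilon> * w * \<bar>D2\<bar>)"
    using key by (simp add: algebra_simps)
  then have "16 * ((B + 2) * \<delta> * \<bar>D1\<bar>) < \<epsilon> * w * \<bar>D2\<bar>" using W by simp
  then have "2 * ((B + 2) * \<delta> * \<bar>D1\<bar>) < \<epsilon> * w * \<bar>D2\<bar>"
    using \<open>0 \<le> (B + 2) * \<delta> * \<bar>D1\<bar>\<close> by linarith
  then show ?thesis using assms by (simp add: field_simps)
qed


section \<open>Absence of common essential invariant curves\<close>

theorem theorem2p4:
  fixes gp gm :: "real \<Rightarrow> complex \<times> complex \<Rightarrow> complex \<times> complex"
    and \<omega> :: "complex \<Rightarrow> real \<Rightarrow> complex"
    and r :: "real \<Rightarrow> complex \<times> complex \<Rightarrow> complex"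
    and \<delta> \<eta> :: "real \<Rightarrow> real"
    and f D :: "real \<Rightarrow> real \<times> real \<Rightarrow> real \<times> real"
    and a b \<rho> \<epsilon>0 \<alpha>1 \<alpha>2 :: real
  assumes "a < b" and "\<rho> > 0" and "\<epsilon>0 > 0" and "\<alpha>1 < \<alpha>2"
    and gp: "exact_symplectic_twist_family \<rho> a b \<epsilon>0 gp"
    and gm: "exact_symplectic_twist_family \<rho> a b \<epsilon>0 gm"
    and \<omega>_hol: "\<And>\<epsilon>. \<epsilon> \<in> {0..<\<epsilon>0} \<Longrightarrow>
                  (\<lambda>G. \<omega> G \<epsilon>) holomorphic_on (\<Union>G\<in>{a..b}. ball (complex_of_real G) \<rho>)"
    and \<omega>_cont: "continuous_on ((\<Union>G\<in>{a..b}. ball (complex_of_real G) \<rho>) \<times> {0..<\<epsilon>0})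
                  (\<lambda>(G, \<epsilon>). \<omega> G \<epsilon>)"
    and \<omega>_real: "\<And>G \<epsilon>. \<epsilon> \<in> {0..<\<epsilon>0} \<Longrightarrow> G \<in> {a-\<rho><..<b+\<rho>} \<Longrightarrow> \<omega> (complex_of_real G) \<epsilon> \<in> \<real>"
    and r_hol: "\<And>\<epsilon>. \<epsilon> \<in> {0<..<\<epsilon>0} \<Longrightarrow> holomorphic2_on (r \<epsilon>) (cnbhd \<rho> a b)"
    and r_periodic: "\<And>\<epsilon> p. \<epsilon> \<in> {0<..<\<epsilon>0} \<Longrightarrow> p \<in> cnbhd \<rho> a b \<Longrightarrow>
                  r \<epsilon> (fst p + complex_of_real (2 * pi), snd p) = r \<epsilon> p"
    and r_real: "\<And>\<epsilon> x. \<epsilon> \<in> {0<..<\<epsilon>0} \<Longrightarrow> cembed x \<in> cnbhd \<rho> a b \<Longrightarrow> r \<epsilon> (cembed x) \<in> \<real>"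
    and \<delta>_pos: "\<And>\<epsilon>. \<epsilon> \<in> {0<..<\<epsilon>0} \<Longrightarrow> \<delta> \<epsilon> > 0"
    and gp_form: "unif_smallo (cnbhd \<rho> a b)
          (\<lambda>\<epsilon> (\<alpha>, G). gp \<epsilon> (\<alpha>, G) -
             (\<alpha> + of_real \<epsilon> * \<omega> G \<epsilon>, G + of_real (\<delta> \<epsilon>) * r \<epsilon> (\<alpha>, G))) \<delta>"
    and gm_form: "unif_smallo (cnbhd \<rho> a b)
          (\<lambda>\<epsilon> (\<alpha>, G). gm \<epsilon> (\<alpha>, G) -
             (\<alpha> + of_real \<epsilon> * \<omega> G \<epsilon>, G + of_real (\<delta> \<epsilon>) * r \<epsilon> (\<alpha>, G))) \<delta>"
    and \<omega>_nonzero: "(INF G\<in>{a..b}. norm (\<omega> (complex_of_real G) 0)) \<noteq> 0"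
    and r_bounded: "unif_bigo (cnbhd \<rho> a b) r (\<lambda>_. 1)"
    and \<delta>_small: "((\<lambda>\<epsilon>. \<delta> \<epsilon> / \<epsilon>) \<longlongrightarrow> 0) (at_right 0)"
    and f_def: "\<And>\<epsilon> \<alpha> G. f \<epsilon> (\<alpha>, G) =
          (- \<delta> \<epsilon> * Re (r \<epsilon> (cembed (\<alpha>, G))), \<epsilon> * Re (\<omega> (complex_of_real G) \<epsilon>))"
    and D_def: "\<And>\<epsilon> x. D \<epsilon> x = real_map (gp \<epsilon>) x - real_map (gm \<epsilon>) x"
    and \<eta>_pos: "\<And>\<epsilon>. \<epsilon> \<in> {0<..<\<epsilon>0} \<Longrightarrow> \<eta> \<epsilon> > 0"
    and transversal: "\<And>\<epsilon>. \<epsilon> \<in> {0<..<\<epsilon>0} \<Longrightarrow>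
          (INF x\<in>{\<alpha>1<..<\<alpha>2} \<times> {a..b}. \<bar>f \<epsilon> x \<bullet> D \<epsilon> x\<bar>) \<ge> \<eta> \<epsilon>"
    and dist_small: "uniform_limit ({\<alpha>1<..<\<alpha>2} \<times> {a..b})
          (\<lambda>\<epsilon> x. \<delta> \<epsilon> * norm (D \<epsilon> x) / \<eta> \<epsilon>) (\<lambda>_. 0) (at_right 0)"
    and \<omega>'_nonzero: "\<forall>\<^sub>F \<epsilon> in at_right 0.
          (INF G\<in>{a..b}. norm (deriv (\<lambda>z. \<omega> z \<epsilon>) (complex_of_real G))) > 0"
    and exp_small: "\<exists>c>0. ((\<lambda>\<epsilon>. sqrt (\<delta> \<epsilon> * exp (- c / \<epsilon>)) /
          (\<epsilon> * (INF G\<in>{a..b}. norm (deriv (\<lambda>z. \<omega> z \<epsilon>) (complex_of_real G))) * \<eta> \<epsilon>)) \<longlongrightarrow> 0) (at_right 0)"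
  shows "\<forall>\<^sub>F \<epsilon> in at_right 0.
           \<not> (\<exists>C. essential_invariant_curve (annulus (a + \<epsilon> powr (1/4)) (b - \<epsilon> powr (1/4)))
                     (real_map (gp \<epsilon>)) C \<and>
                  essential_invariant_curve (annulus (a + \<epsilon> powr (1/4)) (b - \<epsilon> powr (1/4)))
                     (real_map (gm \<epsilon>)) C)"
proof -
  let ?u = "\<lambda>G \<epsilon>. Re (\<omega> (complex_of_real G) \<epsilon>)"
  have \<omega>_dom: "complex_of_real G \<in> (\<Union>G\<in>{a..b}. ball (complex_of_real G) \<rho>)" if "G \<in> {a..b}" for G
    using that \<open>\<rho> > 0\<close> by force
  have u_cont: "continuous_on ({a..b} \<times> {0..<\<epsilon>0}) (\<lambda>(G, \<epsilon>). ?u G \<epsilon>)"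
  proof -
    have "continuous_on ({a..b} \<times> {0..<\<epsilon>0})
            (\<lambda>x. (\<lambda>(G, \<epsilon>). \<omega> G \<epsilon>) (complex_of_real (fst x), snd x))"
      by (rule continuous_on_compose2[OF \<omega>_cont]) (auto intro!: continuous_intros \<omega>_dom)
    then show ?thesis by (simp add: case_prod_unfold continuous_on_Re)
  qed
  have "norm (\<omega> (complex_of_real G) 0) = \<bar>?u G 0\<bar>" if "G \<in> {a..b}" for G
    using \<omega>_real[of 0 G] that \<open>\<rho> > 0\<close> \<open>\<epsilon>0 > 0\<close> by (auto simp: in_Reals_norm)
  then have "(INF G\<in>{a..b}. \<bar>?u G 0\<bar>) \<noteq> 0"
    using \<omega>_nonzero by (simp cong: INF_cong_simp)
  then obtain w W where w: "0 < w" "w \<le> W"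
    and u_ev: "\<forall>\<^sub>F \<epsilon> in at_right 0. \<forall>G\<in>{a..b}. w \<le> \<bar>?u G \<epsilon>\<bar> \<and> \<bar>?u G \<epsilon>\<bar> \<le> W"
    using frequency_bounds[OF less_imp_le[OF \<open>a < b\<close>] \<open>\<epsilon>0 > 0\<close> u_cont] by blast
  obtain B where B: "B > 0" and r_ev: "\<forall>\<^sub>F \<epsilon> in at_right 0. \<forall>p\<in>cnbhd \<rho> a b. norm (r \<epsilon> p) \<le> B"
    using r_bounded unfolding unif_bigo_def by auto
  have \<epsilon>_ev: "\<forall>\<^sub>F \<epsilon> in at_right 0. \<epsilon> \<in> {0<..<\<epsilon>0}"
    using \<open>\<epsilon>0 > 0\<close> by (rule eventually_at_right_real)
  then have \<delta>_ev: "\<forall>\<^sub>F \<epsilon> in at_right 0. \<delta> \<epsilon> > 0"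
    by (rule eventually_mono) (rule \<delta>_pos)
  \<comment> \<open>The remainder \<open>\<delta> \<epsilon>\<close> then costs at most half of the angular step \<open>\<epsilon> * w\<close>.\<close>
  have \<delta>\<epsilon>_ev: "\<forall>\<^sub>F \<epsilon> in at_right 0. \<delta> \<epsilon> / \<epsilon> < w / 2"
    using order_tendstoD(2)[OF \<delta>_small, of "w / 2"] w by simp
  \<comment> \<open>The smallness of \<open>\<delta> * norm D / \<eta>\<close> required by \<open>splitting_estimate\<close>.\<close>
  let ?t = "w / (32 * W * (B + 2))"
  have t: "?t > 0" using w B by simp
  have D_ev: "\<forall>\<^sub>F \<epsilon> in at_right 0. \<forall>x\<in>{\<alpha>1<..<\<alpha>2} \<times> {a..b}. dist (\<delta> \<epsilon> * norm (D \<epsilon> x) / \<eta> \<epsilon>) 0 < ?t"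
    using dist_small t unfolding uniform_limit_iff by blast
  \<comment> \<open>Each step is at most \<open>2 * \<epsilon> * W\<close>, and four of them must fit into the strip.\<close>
  have width_ev: "\<forall>\<^sub>F \<epsilon> in at_right 0. \<epsilon> \<in> {0<..<(\<alpha>2 - \<alpha>1) / (8 * W)}"
    using \<open>\<alpha>1 < \<alpha>2\<close> w by (intro eventually_at_right_real) simp
  note gp_ev = real_map_estimate[OF \<open>\<rho> > 0\<close> gp_form \<delta>_ev r_ev]
  note gm_ev = real_map_estimate[OF \<open>\<rho> > 0\<close> gm_form \<delta>_ev r_ev]
  show ?thesis
    using u_ev r_ev \<epsilon>_ev \<delta>\<epsilon>_ev D_ev width_ev gp_ev gm_ev
  proof eventually_elim
    case (elim \<epsilon>)
    have \<epsilon>: "\<epsilon> > 0" "\<epsilon> \<in> {0..<\<epsilon>0}" and \<delta>: "\<delta> \<epsilon> > 0" and \<eta>: "\<eta> \<epsilon> > 0"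
      using elim(3) \<delta>_pos \<eta>_pos by auto
    have \<delta>\<epsilon>: "\<delta> \<epsilon> < \<epsilon> * w / 2" using elim(4) \<epsilon> by (simp add: field_simps)
    show ?case
    proof
      assume "\<exists>C. essential_invariant_curve (annulus (a + \<epsilon> powr (1/4)) (b - \<epsilon> powr (1/4)))
                     (real_map (gp \<epsilon>)) C \<and>
                  essential_invariant_curve (annulus (a + \<epsilon> powr (1/4)) (b - \<epsilon> powr (1/4)))
                     (real_map (gm \<epsilon>)) C"
      then obtain C where C: "essential_curve (annulus (a + \<epsilon> powr (1/4)) (b - \<epsilon> powr (1/4))) C"
        and inv: "invariant_under (real_map (gp \<epsilon>)) C" "invariant_under (real_map (gm \<epsilon>)) C"
        unfolding essential_invariant_curve_def by blast
      have "a \<le> a + \<epsilon> powr (1/4)" "b - \<epsilon> powr (1/4) \<le> b" by simp_all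
      note S = lifted_curve[OF C this]
      note fam_p = real_map_family[OF gp \<open>\<rho> > 0\<close> elim(3)]
      note fam_m = real_map_family[OF gm \<open>\<rho> > 0\<close> elim(3)]
      show False
      proof (rule no_common_invariant_lift[OF S, where F = "real_map (gp \<epsilon>)" and H = "real_map (gm \<epsilon>)"
            and u = "\<lambda>G. \<epsilon> * ?u G \<epsilon>" and c = "\<epsilon> * w / 2" and l = "2 * \<epsilon> * W" and \<delta> = "\<delta> \<epsilon>"
            and \<kappa> = "(B + 1) * \<delta> \<epsilon>" and \<mu> = "2 * (B + 2) * \<delta> \<epsilon> / (\<epsilon> * w)"
            and \<alpha> = \<alpha>1 and \<beta> = \<alpha>2])
        show "real_map (gp \<epsilon>) ` (cover -` C) = cover -` C"
          by (rule lift_image_eq[where F = "real_map (gp \<epsilon>)", OF inv(1) S(3) fam_p(2)])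
        show "real_map (gm \<epsilon>) ` (cover -` C) = cover -` C"
          by (rule lift_image_eq[where F = "real_map (gm \<epsilon>)", OF inv(2) S(3) fam_m(2)])
        show "continuous_on (UNIV \<times> {a..b}) (real_map (gp \<epsilon>))"
          "continuous_on (UNIV \<times> {a..b}) (real_map (gm \<epsilon>))"
          by (fact fam_p(1), fact fam_m(1))
        have "continuous_on {a..b} (\<lambda>G. (\<lambda>(G, \<epsilon>). ?u G \<epsilon>) (G, \<epsilon>))"
          by (rule continuous_on_compose2[OF u_cont]) (use \<epsilon> in \<open>auto intro!: continuous_intros\<close>)
        then show "continuous_on {a..b} (\<lambda>G. \<epsilon> * ?u G \<epsilon>)"
          by (auto intro!: continuous_intros)
        show "\<epsilon> * w / 2 \<le> \<bar>\<epsilon> * ?u G \<epsilon>\<bar> - \<delta> \<epsilon> \<and> \<bar>\<epsilon> * ?u G \<epsilon>\<bar> + \<delta> \<epsilon> \<le> 2 * \<epsilon> * W"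
          if "G \<in> {a..b}" for G
        proof -
          have "\<epsilon> * w \<le> \<epsilon> * \<bar>?u G \<epsilon>\<bar>" "\<epsilon> * \<bar>?u G \<epsilon>\<bar> \<le> \<epsilon> * W" "\<epsilon> * w \<le> \<epsilon> * W" "0 < \<epsilon> * w"
            using elim(1) that \<epsilon> w by simp_all
          moreover have "\<bar>\<epsilon> * ?u G \<epsilon>\<bar> = \<epsilon> * \<bar>?u G \<epsilon>\<bar>" using \<epsilon> by (simp add: abs_mult)
          moreover have "2 * \<epsilon> * W = \<epsilon> * W + \<epsilon> * W" by simp
          ultimately show ?thesis using \<delta>\<epsilon> by linarith
        qed
        show "\<bar>fst (real_map (gp \<epsilon>) x) - fst x - \<epsilon> * ?u (snd x) \<epsilon>\<bar> \<le> \<delta> \<epsilon> \<and>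
              \<bar>snd (real_map (gp \<epsilon>) x) - snd x\<bar> \<le> (B + 1) * \<delta> \<epsilon>"
          if "x \<in> UNIV \<times> {a..b}" for x using elim(7) that by blast
        show "\<bar>fst (real_map (gm \<epsilon>) x) - fst x - \<epsilon> * ?u (snd x) \<epsilon>\<bar> \<le> \<delta> \<epsilon>"
          if "x \<in> UNIV \<times> {a..b}" for x using elim(8) that by blast
        show "2 * (B + 2) * \<delta> \<epsilon> / (\<epsilon> * w) * \<bar>fst (real_map (gp \<epsilon>) x) - fst (real_map (gm \<epsilon>) x)\<bar>
              < \<bar>snd (real_map (gp \<epsilon>) x) - snd (real_map (gm \<epsilon>) x)\<bar>"
          if x: "x \<in> {\<alpha>1<..<\<alpha>2} \<times> {a..b}" for x
        proof -
          have "\<eta> \<epsilon> \<le> (INF x\<in>{\<alpha>1<..<\<alpha>2} \<times> {a..b}. \<bar>f \<epsilon> x \<bullet> D \<epsilon> x\<bar>)"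
            by (rule transversal[OF elim(3)])
          also have "\<dots> \<le> \<bar>f \<epsilon> x \<bullet> D \<epsilon> x\<bar>"
            using x by (intro cINF_lower bdd_belowI2[of _ 0]) auto
          finally have big: "\<eta> \<epsilon> \<le> \<bar>- \<delta> \<epsilon> * Re (r \<epsilon> (cembed x)) * fst (D \<epsilon> x) + \<epsilon> * ?u (snd x) \<epsilon> * snd (D \<epsilon> x)\<bar>"
            using f_def[of \<epsilon> "fst x" "snd x"] by (simp add: inner_prod_def)
          have x': "snd x \<in> {a..b}" "x \<in> UNIV \<times> {a..b}" using x by auto
          have "\<bar>Re (r \<epsilon> (cembed x))\<bar> \<le> B"
            using order_trans[OF abs_Re_le_cmod elim(2)[rule_format, OF cembed_in_cnbhd[OF x'(2) \<open>\<rho> > 0\<close>]]] .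
          moreover have "\<delta> \<epsilon> * norm (D \<epsilon> x) / \<eta> \<epsilon> < ?t"
            using elim(5)[rule_format, OF x] unfolding dist_real_def by linarith
          then have "\<delta> \<epsilon> * norm (fst (D \<epsilon> x), snd (D \<epsilon> x)) \<le> ?t * \<eta> \<epsilon>"
            using \<eta> by (simp add: pos_divide_less_eq less_imp_le)
          ultimately have "2 * (B + 2) * \<delta> \<epsilon> / (\<epsilon> * w) * \<bar>fst (D \<epsilon> x)\<bar> < \<bar>snd (D \<epsilon> x)\<bar>"
            using splitting_estimate[OF w less_imp_le[OF B] \<epsilon>(1) \<delta> \<eta> _ _ big] elim(1) x'(1) by blast
          then show ?thesis by (simp add: D_def)
        qed
        show "\<epsilon> * w / 2 > 0" "\<delta> \<epsilon> > 0" "2 * (B + 2) * \<delta> \<epsilon> / (\<epsilon> * w) > 0"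
          using \<epsilon> w \<delta> B by simp_all
        show "(B + 1) * \<delta> \<epsilon> < 2 * (B + 2) * \<delta> \<epsilon> / (\<epsilon> * w) * (\<epsilon> * w / 2)"
          using \<epsilon> w \<delta> B by (simp add: field_simps)
        show "4 * (2 * \<epsilon> * W) < \<alpha>2 - \<alpha>1"
          using elim(6) w by (simp add: field_simps)
      qed
    qed
  qed
qed

end
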